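(* Let $(\mathfrak{A},\omega,\tau,K)$ be a $\ast$-dynamical system, where $K$ is a Borel measurable subsemigroup of a locally compact Hausdorff group $G$ with right Haar measure $\mu$, and assume $K$ is abelian (i.e. $gh=hg$ for all $g,h\in K$). Let $\{\Lambda_{\alpha}\}$ be a space-filling net in $K$. Then for any $A,B\in\mathfrak{A}$ and $\varepsilon>0$ there exists an $\alpha_{0}$ such that $$\left|\frac{1}{\mu(\Lambda_{\alpha_{0}})}\int_{\Lambda_{\alpha_{0}}h}\omega(A^{\ast}\tau_{g}(B))\,d\mu(g)\right|>\left|\lim_{\alpha}\frac{1}{\mu(\Lambda_{\alpha})}\int_{\Lambda_{\alpha}}\omega(A^{\ast}\tau_{g}(B))\,d\mu(g)\right|-\varepsilon$$ for all $h\in K$ (the existence of the limit on the right being part of the assertion). In particular, if $A=B$, then for every $h\in K$ $$|\omega(A^{\ast}\tau_{g}(A))|>|\omega(A)|^{2}-\varepsilon$$ for some $g\in\Lambda_{\alpha_{0}}h$.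
   Context: A subsemigroup of a group $G$ is a subset $K\subset G$ (with $K=G$ allowed) such that $gh\in K$ for all $g,h\in K$. $\ast$-dynamical system: Let $\omega$ be a state on a (complex) unital $\ast$-algebra $\mathfrak{A}$, i.e. a linear functional with $\omega(A^{\ast}A)\geq 0$ for all $A\in\mathfrak{A}$ and $\omega(1)=1$. Let $G$ be a locally compact Hausdorff group with right Haar measure $\mu$, and $K$ a Borel measurable subsemigroup of $G$. Let $L(\mathfrak{A})$ be the space of linear operators $\mathfrak{A}\to\mathfrak{A}$, and let $\tau:K\rightarrow L(\mathfrak{A}):g\mapsto\tau_{g}$ satisfy $\tau_{g}\circ\tau_{h}=\tau_{gh}$, $\tau_{g}(1)=1$ and $\omega(\tau_{g}(A)^{\ast}\tau_{g}(A))\leq\omega(A^{\ast}A)$ for all $g,h\in K$ and $A\in\mathfrak{A}$, and be such that $K\ni g\mapsto\omega(A^{\ast}\tau_{g}(B))$ is Borel measurable for all $A,B\in\mathfrak{A}$. Then $(\mathfrak{A},\omega,\tau,K)$ is called a $\ast$-dynamical system. A net $\{\Lambda_{\alpha}\}$ is a family of subsets of $G$ indexed by a directed set. A net $\{\Lambda_{\alpha}\}$ of Borel subsets of $G$ is called space-filling in $K$ if $\Lambda_{\alpha}\subset K$ and $\mu(\Lambda_{\alpha})<\infty$ for all $\alpha$, $\mu(\Lambda_{\alpha})>0$ for all $\alpha$ large enough (i.e. for all $\alpha\geq\alpha_{1}$, for some $\alpha_{1}$), and $$\lim_{\alpha}\frac{\mu(\Lambda_{\alpha}\Delta(\Lambda_{\alpha}g))}{\mu(\Lambda_{\alpha})}=0$$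 for all $g\in K$, where $A\Delta B:=(A\cup B)\setminus(A\cap B)$ and $\Lambda g:=\{kg:k\in\Lambda\}$. Whenever $1/\mu(\Lambda_{\alpha_0})$ is written, it is understood that $\mu(\Lambda_{\alpha_0})>0$. *)

theory Defs
  imports "HOL-Analysis.Analysis"
begin

text \<open>
  The group \<open>G\<close> is rendered by a type of class \<^class>\<open>topological_group_add\<close>. This class does
  not assume commutativity: \<open>g + h\<close> stands for the product \<open>gh\<close> of a possibly non-abelian group,
  and \<open>(\<lambda>k. k + g) ` \<Lambda>\<close> is the right translate \<open>\<Lambda>g\<close>.
\<close>

text \<open>
  The class \<^class>\<open>ring_1\<close> only excludes the zero algebra, on which no state exists.
\<close>

locale unital_star_algebra = vector_space scale
  for scale :: "complex \<Rightarrow> 'a::ring_1 \<Rightarrow> 'a" +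
  fixes star :: "'a \<Rightarrow> 'a"
  assumes scale_mult_left: "scale c x * y = scale c (x * y)"
    and scale_mult_right: "x * scale c y = scale c (x * y)"
    and star_star: "star (star x) = x"
    and star_mult: "star (x * y) = star y * star x"
    and star_add: "star (x + y) = star x + star y"
    and star_scale: "star (scale c x) = scale (cnj c) (star x)"

locale state_on_star_algebra = unital_star_algebra scale star
  for scale :: "complex \<Rightarrow> 'a::ring_1 \<Rightarrow> 'a" and star :: "'a \<Rightarrow> 'a" +
  fixes \<omega> :: "'a \<Rightarrow> complex"
  assumes state_linear: "Vector_Spaces.linear scale (*) \<omega>"
    and state_positive: "\<omega> (star A * A) \<in> \<real>\<^sub>\<ge>\<^sub>0"
    and state_one: "\<omega> 1 = 1"

definition subsemigroup :: "'g::group_add set \<Rightarrow> bool" where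
  "subsemigroup K \<longleftrightarrow> (\<forall>g\<in>K. \<forall>h\<in>K. g + h \<in> K)"

text \<open>
  The values of \<open>\<tau>\<close> outside \<open>K\<close> are irrelevant. In \<open>evolution_contractive\<close> both values
  of \<open>\<omega>\<close> are nonnegative reals, so comparing real parts is comparing them.
\<close>

locale star_dynamical_system = state_on_star_algebra scale star \<omega>
  for scale :: "complex \<Rightarrow> 'a::ring_1 \<Rightarrow> 'a" and star :: "'a \<Rightarrow> 'a" and \<omega> :: "'a \<Rightarrow> complex" +
  fixes \<tau> :: "'g::{topological_group_add, t2_space} \<Rightarrow> 'a \<Rightarrow> 'a"
    and K :: "'g set"
  assumes borel_K: "K \<in> sets borel"
    and subsemigroup_K: "subsemigroup K"
    and evolution_linear: "g \<in> K \<Longrightarrow> Vector_Spaces.linear scale scale (\<tau> g)"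
    and evolution_comp: "g \<in> K \<Longrightarrow> h \<in> K \<Longrightarrow> \<tau> g \<circ> \<tau> h = \<tau> (g + h)"
    and evolution_one: "g \<in> K \<Longrightarrow> \<tau> g 1 = 1"
    and evolution_contractive:
      "g \<in> K \<Longrightarrow> Re (\<omega> (star (\<tau> g A) * \<tau> g A)) \<le> Re (\<omega> (star A * A))"
    and evolution_measurable:
      "(\<lambda>g. \<omega> (star A * \<tau> g B)) \<in> borel_measurable (restrict_space borel K)"

text \<open>
  A right Haar measure is a nonzero right-invariant Borel measure that is finite on compact sets,
  outer regular on Borel sets and inner regular on open sets.
\<close>

definition right_haar_measure :: "'g::{topological_group_add, t2_space} measure \<Rightarrow> bool" where
  "right_haar_measure \<mu> \<longleftrightarrow>
     sets \<mu> = sets borel \<and>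
     emeasure \<mu> UNIV \<noteq> 0 \<and>
     (\<forall>A\<in>sets borel. \<forall>g. emeasure \<mu> ((\<lambda>k. k + g) ` A) = emeasure \<mu> A) \<and>
     (\<forall>C. compact C \<longrightarrow> emeasure \<mu> C < \<infinity>) \<and>
     (\<forall>A\<in>sets borel. emeasure \<mu> A = (INF U\<in>{U. open U \<and> A \<subseteq> U}. emeasure \<mu> U)) \<and>
     (\<forall>U. open U \<longrightarrow> emeasure \<mu> U = (SUP C\<in>{C. compact C \<and> C \<subseteq> U}. emeasure \<mu> C))"

definition directed_set :: "'i set \<Rightarrow> ('i \<Rightarrow> 'i \<Rightarrow> bool) \<Rightarrow> bool" where
  "directed_set I le \<longleftrightarrow>
     I \<noteq> {} \<and>
     (\<forall>a\<in>I. le a a) \<and>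
     (\<forall>a\<in>I. \<forall>b\<in>I. \<forall>c\<in>I. le a b \<longrightarrow> le b c \<longrightarrow> le a c) \<and>
     (\<forall>a\<in>I. \<forall>b\<in>I. \<exists>c\<in>I. le a c \<and> le b c)"

text \<open>The filter along which nets indexed by \<open>I\<close> converge, see \<open>eventually_net_filter\<close>.\<close>

definition net_filter :: "'i set \<Rightarrow> ('i \<Rightarrow> 'i \<Rightarrow> bool) \<Rightarrow> 'i filter" where
  "net_filter I le = (INF a\<in>I. principal {b \<in> I. le a b})"

lemma eventually_net_filter:
  assumes "directed_set I le"
  shows "eventually P (net_filter I le) \<longleftrightarrow> (\<exists>a\<in>I. \<forall>b\<in>I. le a b \<longrightarrow> P b)"
proof -
  have "eventually P (net_filter I le) \<longleftrightarrow>
      (\<exists>a\<in>I. eventually P (principal {b \<in> I. le a b}))"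
    unfolding net_filter_def
  proof (rule eventually_INF_base)
    show "I \<noteq> {}"
      using assms by (simp add: directed_set_def)
    fix a b assume ab: "a \<in> I" "b \<in> I"
    then obtain c where c: "c \<in> I" "le a c" "le b c"
      using assms unfolding directed_set_def by blast
    have "{d \<in> I. le c d} \<subseteq> {d \<in> I. le a d} \<inter> {d \<in> I. le b d}"
      using assms ab c unfolding directed_set_def by blast
    then show "\<exists>x\<in>I. principal {d \<in> I. le x d} \<le>
        inf (principal {d \<in> I. le a d}) (principal {d \<in> I. le b d})"
      using c(1) by auto
  qed
  then show ?thesis
    by (auto simp: eventually_principal)
qed

definition space_filling ::
  "'g::{topological_group_add, t2_space} measure \<Rightarrow> 'g set \<Rightarrow>
   'i set \<Rightarrow> ('i \<Rightarrow> 'i \<Rightarrow> bool) \<Rightarrow> ('i \<Rightarrow> 'g set) \<Rightarrow> bool" where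
  "space_filling \<mu> K I le \<Lambda> \<longleftrightarrow>
     (\<forall>\<alpha>\<in>I. \<Lambda> \<alpha> \<in> sets borel \<and> \<Lambda> \<alpha> \<subseteq> K \<and> emeasure \<mu> (\<Lambda> \<alpha>) < \<infinity>) \<and>
     (\<exists>\<alpha>\<^sub>1\<in>I. \<forall>\<alpha>\<in>I. le \<alpha>\<^sub>1 \<alpha> \<longrightarrow> emeasure \<mu> (\<Lambda> \<alpha>) > 0) \<and>
     (\<forall>g\<in>K. ((\<lambda>\<alpha>. measure \<mu> ((\<Lambda> \<alpha> \<union> (\<lambda>k. k + g) ` \<Lambda> \<alpha>) - (\<Lambda> \<alpha> \<inter> (\<lambda>k. k + g) ` \<Lambda> \<alpha>))
                    / measure \<mu> (\<Lambda> \<alpha>)) \<longlongrightarrow> 0) (net_filter I le))"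

end

theory Submission
  imports Defs
begin

text \<open>
  This is the mean ergodic theorem for the positive form \<open>\<langle>X, Y\<rangle> = \<omega> (star X * Y)\<close>, run without
  completing to a Hilbert space. An element \<open>C\<close> of almost minimal seminorm among the midpoint means of
  the orbit of \<open>B\<close> is almost invariant by the parallelogram law, while \<open>B - C\<close> is a mean of coboundaries
  \<open>B - \<tau> g B\<close>, whose averages over \<open>\<Lambda>\<close> are at most \<open>\<mu> (\<Lambda> \<Delta> \<Lambda>g) / \<mu> \<Lambda>\<close> up to a
  constant. Hence the averages of \<open>\<langle>A, \<tau> k B\<rangle>\<close> eventually stay close to \<open>\<langle>A, C\<rangle>\<close>. As \<open>K\<close> is abelian,
  replacing \<open>B\<close> by \<open>\<tau> h B\<close>, i.e. \<open>\<Lambda>\<close> by \<open>\<Lambda>h\<close>, changes none of the estimates, so they are uniform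
  in \<open>h\<close>. For \<open>A = B\<close>, the defect form \<open>\<langle>X, Y\<rangle> - \<langle>\<tau> g X, \<tau> g Y\<rangle>\<close> of the contraction \<open>\<tau> g\<close> is
  again positive; its Cauchy-Schwarz inequality gives \<open>\<langle>A, C\<rangle> \<approx> \<langle>C, C\<rangle>\<close> as well as
  \<open>\<omega> \<circ> \<tau> g = \<omega>\<close>, and \<open>\<langle>C, C\<rangle> \<ge> \<bar>\<omega> C\<bar>\<^sup>2 = \<bar>\<omega> A\<bar>\<^sup>2\<close>.
\<close>

section \<open>Positive, possibly degenerate sesquilinear forms\<close>

locale positive_form = vector_space scale
  for scale :: "complex \<Rightarrow> 'a::ab_group_add \<Rightarrow> 'a" +
  fixes p :: "'a \<Rightarrow> 'a \<Rightarrow> complex"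
  assumes add_left: "p (x + y) z = p x z + p y z"
    and add_right: "p x (y + z) = p x y + p x z"
    and scale_left: "p (scale c x) y = cnj c * p x y"
    and scale_right: "p x (scale c y) = c * p x y"
    and nonneg: "p x x \<in> \<real>\<^sub>\<ge>\<^sub>0"
begin

text \<open>This is the square of a seminorm only: it may vanish at nonzero vectors, since nothing
  is quotiented out.\<close>

definition normsq :: "'a \<Rightarrow> real" where
  "normsq x = Re (p x x)"

lemma normsq_nonneg: "normsq x \<ge> 0"
  using nonneg[of x] by (auto simp: normsq_def complex_nonneg_Reals_iff)

lemma of_real_normsq: "complex_of_real (normsq x) = p x x"
  using nonneg[of x] by (auto simp: normsq_def complex_nonneg_Reals_iff complex_eq_iff)

lemma minus_left: "p (- x) y = - p x y"
  using scale_left[of "-1" x y] by simp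

lemma minus_right: "p x (- y) = - p x y"
  using scale_right[of x "-1" y] by simp

lemma diff_left: "p (x - y) z = p x z - p y z"
  using add_left[of x "- y" z] by (simp add: minus_left)

lemma diff_right: "p x (y - z) = p x y - p x z"
  using add_right[of x y "- z"] by (simp add: minus_right)

lemma combination_expand:
  "p (scale s x + scale t y) (scale s x + scale t y)
    = cnj s * s * p x x + cnj s * t * p x y + cnj t * s * p y x + cnj t * t * p y y"
  by (simp add: add_left add_right scale_left scale_right algebra_simps)

text \<open>Polarization: the diagonal values at \<open>x + y\<close> and at
  \<open>x + \<i> y\<close> are real, which fixes the imaginary and the real part of
  \<open>p y x\<close> respectively.\<close>

lemma hermitian: "p y x = cnj (p x y)"
proof -
  have "Im (p (scale 1 x + scale 1 y) (scale 1 x + scale 1 y)) = 0"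
    "Im (p (scale 1 x + scale \<i> y) (scale 1 x + scale \<i> y)) = 0"
    "Im (p x x) = 0" "Im (p y y) = 0"
    using nonneg by (auto simp: complex_nonneg_Reals_iff)
  then show ?thesis
    unfolding combination_expand by (auto simp: complex_eq_iff)
qed

lemma normsq_combination:
  "normsq (scale s x + scale t y)
    = (cmod s)\<^sup>2 * normsq x + 2 * Re (cnj s * t * p x y) + (cmod t)\<^sup>2 * normsq y"
proof -
  have "cnj s * s * p x x = of_real ((cmod s)\<^sup>2 * normsq x)"
    "cnj t * t * p y y = of_real ((cmod t)\<^sup>2 * normsq y)"
    by (simp_all only: of_real_mult of_real_normsq complex_norm_square)
       (simp_all add: mult.commute)
  moreover have "cnj t * s * p y x = cnj (cnj s * t * p x y)"
    by (simp add: hermitian[of y x])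
  ultimately show ?thesis
    by (simp only: normsq_def combination_expand) (simp add: algebra_simps)
qed

lemma Cauchy_Schwarz: "(cmod (p x y))\<^sup>2 \<le> normsq x * normsq y"
proof -
  let ?b = "p x y"
  \<comment> \<open>The factor \<open>cnj ?b\<close> in the coefficient of \<open>y\<close> turns
    the cross term into a real number, leaving a quadratic form in real \<open>s\<close> and
    \<open>r\<close>.\<close>
  have eq: "cnj (of_real s) * (of_real r * cnj ?b) * ?b = of_real (s * r * (cmod ?b)\<^sup>2)" for s r :: real
    by (simp only: of_real_mult complex_norm_square) simp
  have ineq: "0 \<le> s\<^sup>2 * normsq x + 2 * (s * r * (cmod ?b)\<^sup>2) + r\<^sup>2 * (cmod ?b)\<^sup>2 * normsq y" for s r :: real
    using normsq_nonneg[of "scale (of_real s) x + scale (of_real r * cnj ?b) y"]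
    unfolding normsq_combination eq
    by (simp add: norm_mult power_mult_distrib)
  show ?thesis
  proof (cases "normsq y = 0")
    case True
    have "?b = 0"
    proof (rule ccontr)
      assume "?b \<noteq> 0"
      \<comment> \<open>With \<open>s = 1\<close> and \<open>normsq y = 0\<close> the inequality is
        linear in \<open>r\<close>; this \<open>r\<close> makes its right side
        \<open>- normsq x - 2\<close>.\<close>
      then show False
        using ineq[of 1 "- (normsq x + 1) / (cmod ?b)\<^sup>2"] normsq_nonneg[of x] True by simp
    qed
    then show ?thesis
      using normsq_nonneg by simp
  next
    case False
    then have pos: "normsq y > 0"
      using normsq_nonneg[of y] by simp
    have "0 \<le> normsq y * (normsq x * normsq y - (cmod ?b)\<^sup>2)"
      using ineq[of "normsq y" "-1"] by (simp add: algebra_simps power2_eq_square)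
    with pos show ?thesis
      by (simp add: zero_le_mult_iff)
  qed
qed

lemma cmod_le_sqrt: "cmod (p x y) \<le> sqrt (normsq x * normsq y)"
  by (rule real_le_rsqrt) (rule Cauchy_Schwarz)

text \<open>Stated with the midpoint instead of the sum, because \<open>orbit_means\<close> below is
  closed under midpoints.\<close>

lemma parallelogram:
  "normsq (x - y) = 2 * normsq x + 2 * normsq y - 4 * normsq (scale (1/2) (x + y))"
  by (simp add: normsq_def add_left add_right diff_left diff_right scale_left scale_right field_simps)

end

section \<open>The GNS form of a state, and means over orbits\<close>

lemma Vector_Spaces_linearD:
  assumes "Vector_Spaces.linear s1 s2 f"
  shows "f (x + y) = f x + f y" "f (s1 c x) = s2 c (f x)"
proof -
  interpret Vector_Spaces.linear s1 s2 f by fact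
  show "f (x + y) = f x + f y" "f (s1 c x) = s2 c (f x)"
    by (rule add scale)+
qed

lemma (in unital_star_algebra) star_one: "star 1 = 1"
  using star_mult[of "star 1" 1] by (simp add: star_star)

sublocale state_on_star_algebra \<subseteq> gns: positive_form scale "\<lambda>x y. \<omega> (star x * y)"
  by unfold_locales
     (simp_all add: star_add star_scale scale_mult_left scale_mult_right distrib_left distrib_right
        Vector_Spaces_linearD[OF state_linear] state_positive)

context state_on_star_algebra
begin

lemma normsq_one: "gns.normsq 1 = 1"
  by (simp add: gns.normsq_def star_one state_one)

lemma cmod_state_le: "(cmod (\<omega> X))\<^sup>2 \<le> gns.normsq X"
  using gns.Cauchy_Schwarz[of 1 X] by (simp add: star_one normsq_one)

end

text \<open>Dyadic convex combinations suffice for the parallelogram law, and generating them by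
  midpoints allows proofs by induction. \<open>B\<close> itself need not belong: \<open>K\<close>
  may lack the identity, and \<tau> at the identity is not assumed to be \<open>id\<close>.\<close>

inductive_set orbit_means :: "(complex \<Rightarrow> 'a::ring_1 \<Rightarrow> 'a) \<Rightarrow> ('g \<Rightarrow> 'a \<Rightarrow> 'a) \<Rightarrow> 'g set \<Rightarrow> 'a \<Rightarrow> 'a set"
  for scale \<tau> K B where
  orbit: "g \<in> K \<Longrightarrow> \<tau> g B \<in> orbit_means scale \<tau> K B"
| midpoint: "C \<in> orbit_means scale \<tau> K B \<Longrightarrow> D \<in> orbit_means scale \<tau> K B \<Longrightarrow>
    scale (1/2) (C + D) \<in> orbit_means scale \<tau> K B"

section \<open>The defect form of a contraction and almost invariant means\<close>

context star_dynamical_system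
begin

lemma evolution_add: "g \<in> K \<Longrightarrow> \<tau> g (X + Y) = \<tau> g X + \<tau> g Y"
  and evolution_scale: "g \<in> K \<Longrightarrow> \<tau> g (scale c X) = scale c (\<tau> g X)"
  using Vector_Spaces_linearD[OF evolution_linear] by auto

lemma add_mem: "g \<in> K \<Longrightarrow> h \<in> K \<Longrightarrow> g + h \<in> K"
  using subsemigroup_K by (auto simp: subsemigroup_def)

lemma evolution_evolution: "g \<in> K \<Longrightarrow> h \<in> K \<Longrightarrow> \<tau> g (\<tau> h X) = \<tau> (g + h) X"
  using evolution_comp[of g h] by (metis comp_apply)

lemma normsq_evolution_le: "g \<in> K \<Longrightarrow> gns.normsq (\<tau> g X) \<le> gns.normsq X"
  using evolution_contractive by (simp add: gns.normsq_def)

text \<open>Positivity on the diagonal is exactly contractivity of \<open>\<tau> g\<close>; the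
  interpretation then yields Cauchy-Schwarz off the diagonal.\<close>

lemma positive_form_defect:
  assumes "g \<in> K"
  shows "positive_form scale (\<lambda>x y. \<omega> (star x * y) - \<omega> (star (\<tau> g x) * \<tau> g y))"
proof unfold_locales
  show "\<omega> (star x * x) - \<omega> (star (\<tau> g x) * \<tau> g x) \<in> \<real>\<^sub>\<ge>\<^sub>0" for x
    using evolution_contractive[OF assms, of x] state_positive[of x] state_positive[of "\<tau> g x"]
    by (simp add: complex_nonneg_Reals_iff)
qed (use assms in \<open>simp_all add: evolution_add evolution_scale gns.add_left gns.add_right
        gns.scale_left gns.scale_right add_diff_add right_diff_distrib\<close>)

text \<open>The defect of \<open>X\<close> is bounded crudely by \<open>normsq X\<close>, that of
  \<open>Y\<close> is kept. Thus a small defect of \<open>Y\<close> alone makes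
  \<open>\<tau> g\<close> almost preserve the pairing of \<open>Y\<close> with any
  \<open>X\<close>.\<close>

lemma defect_Cauchy_Schwarz:
  assumes "g \<in> K"
  shows "(cmod (\<omega> (star X * Y) - \<omega> (star (\<tau> g X) * \<tau> g Y)))\<^sup>2
    \<le> gns.normsq X * (gns.normsq Y - gns.normsq (\<tau> g Y))"
proof -
  interpret D: positive_form scale "\<lambda>x y. \<omega> (star x * y) - \<omega> (star (\<tau> g x) * \<tau> g y)"
    by (rule positive_form_defect[OF assms])
  have D: "D.normsq Z = gns.normsq Z - gns.normsq (\<tau> g Z)" for Z
    by (simp add: D.normsq_def gns.normsq_def)
  have "D.normsq X * D.normsq Y \<le> gns.normsq X * D.normsq Y"
    by (rule mult_right_mono[OF _ D.normsq_nonneg]) (simp add: D gns.normsq_nonneg)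
  then show ?thesis
    using D.Cauchy_Schwarz[of X Y] by (simp add: D)
qed

text \<open>The unit is fixed by \<open>\<tau> g\<close>, so its defect is zero and pairings with it
  are preserved exactly. Hermitian symmetry moves the star outside, as \<open>\<tau> g\<close> is
  not assumed to commute with \<open>star\<close>.\<close>

lemma state_evolution:
  assumes "g \<in> K"
  shows "\<omega> (\<tau> g X) = \<omega> X"
  using defect_Cauchy_Schwarz[OF assms, of X 1] assms
    gns.hermitian[of 1 X] gns.hermitian[of 1 "\<tau> g X"]
  by (simp add: evolution_one star_one)

lemma orbit_means_evolution:
  assumes "C \<in> orbit_means scale \<tau> K B" "g \<in> K"
  shows "\<tau> g C \<in> orbit_means scale \<tau> K B"
  using assms
  by (induction) (auto simp: evolution_evolution evolution_add evolution_scale add_mem intro: orbit_means.intros)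

lemma state_orbit_means:
  assumes "C \<in> orbit_means scale \<tau> K B"
  shows "\<omega> C = \<omega> B"
  using assms
  by induction (auto simp: state_evolution Vector_Spaces_linearD[OF state_linear])

lemma almost_invariant_mean:
  assumes "K \<noteq> {}" "\<delta> > 0"
  obtains C where "C \<in> orbit_means scale \<tau> K B"
    and "\<And>g. g \<in> K \<Longrightarrow> gns.normsq (\<tau> g C - C) \<le> \<delta>"
    and "\<And>g. g \<in> K \<Longrightarrow> gns.normsq C - gns.normsq (\<tau> g C) \<le> \<delta>"
proof -
  let ?S = "orbit_means scale \<tau> K B"
  define d where "d = (INF C\<in>?S. gns.normsq C)"
  have bdd: "bdd_below (gns.normsq ` ?S)"
    using gns.normsq_nonneg by (auto intro!: bdd_belowI[of _ 0])
  have d_le: "d \<le> gns.normsq C" if "C \<in> ?S" for C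
    unfolding d_def by (rule cINF_lower[OF bdd that])
  have "?S \<noteq> {}"
    using assms(1) orbit_means.orbit by fastforce
  \<comment> \<open>Both \<open>C\<close> and \<open>\<tau> g C\<close> have \<open>normsq\<close>
    below \<open>d + \<delta> / 4\<close> and their midpoint has at least \<open>d\<close>, so the
    parallelogram law leaves \<open>4 * (d + \<delta> / 4) - 4 * d = \<delta>\<close>.\<close>
  then obtain C where C: "C \<in> ?S" "gns.normsq C < d + \<delta> / 4"
    using cINF_less_iff[OF _ bdd, of "d + \<delta> / 4"] assms(2) by (auto simp: d_def)
  show thesis
  proof (rule that[OF C(1)])
    fix g assume g: "g \<in> K"
    have S: "\<tau> g C \<in> ?S" "scale (1/2) (\<tau> g C + C) \<in> ?S"
      using C(1) g by (auto intro: orbit_means_evolution orbit_means.midpoint)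
    show "gns.normsq (\<tau> g C - C) \<le> \<delta>"
      using gns.parallelogram[of "\<tau> g C" C] d_le[OF S(2)] normsq_evolution_le[OF g, of C] C(2)
      by linarith
    show "gns.normsq C - gns.normsq (\<tau> g C) \<le> \<delta>"
      using d_le[OF S(1)] C(2) assms(2) by linarith
  qed
qed

text \<open>On the orbit, \<langle>A, D\<rangle> is close to \<langle>\<tau> g A, \<tau> g
  D\<rangle> by the small defect of \<open>D\<close>, and that to \<langle>\<tau> g A, D\<rangle> by
  almost invariance; hence the factor 2. Midpoints average the errors. The later use has
  \<open>D\<close> itself as the mean \<open>C\<close>.\<close>

lemma cmod_diff_orbit_means:
  assumes C: "C \<in> orbit_means scale \<tau> K A"
    and inv: "\<And>g. g \<in> K \<Longrightarrow> gns.normsq (\<tau> g D - D) \<le> \<delta>"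
    and defect: "\<And>g. g \<in> K \<Longrightarrow> gns.normsq D - gns.normsq (\<tau> g D) \<le> \<delta>"
  shows "cmod (\<omega> (star A * D) - \<omega> (star C * D)) \<le> 2 * sqrt (gns.normsq A * \<delta>)"
  using C
proof induction
  case (orbit g)
  have "cmod (\<omega> (star A * D) - \<omega> (star (\<tau> g A) * \<tau> g D)) \<le> sqrt (gns.normsq A * \<delta>)"
    by (rule real_le_rsqrt, rule order_trans[OF defect_Cauchy_Schwarz[OF orbit]])
       (intro mult_left_mono defect orbit gns.normsq_nonneg)
  moreover have "cmod (\<omega> (star (\<tau> g A) * (\<tau> g D - D))) \<le> sqrt (gns.normsq A * \<delta>)"
    by (rule order_trans[OF gns.cmod_le_sqrt])
       (intro real_sqrt_le_mono mult_mono inv normsq_evolution_le orbit gns.normsq_nonneg)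
  ultimately show ?case
    using norm_triangle_ineq[of "\<omega> (star A * D) - \<omega> (star (\<tau> g A) * \<tau> g D)" "\<omega> (star (\<tau> g A) * (\<tau> g D - D))"]
    by (simp add: gns.diff_right)
next
  case (midpoint C E)
  have "\<omega> (star A * D) - \<omega> (star (scale (1/2) (C + E)) * D)
     = ((\<omega> (star A * D) - \<omega> (star C * D)) + (\<omega> (star A * D) - \<omega> (star E * D))) / 2"
    by (simp add: gns.scale_left gns.add_left field_simps)
  then show ?case
    using midpoint.IH norm_triangle_ineq[of "\<omega> (star A * D) - \<omega> (star C * D)" "\<omega> (star A * D) - \<omega> (star E * D)"]
    by (simp only: norm_divide) simp
qed

lemma cmod_matrix_coefficient_le:
  assumes "g \<in> K"
  shows "cmod (\<omega> (star A * \<tau> g X)) \<le> sqrt (gns.normsq A * gns.normsq X)"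
  by (rule order_trans[OF gns.cmod_le_sqrt])
     (intro real_sqrt_le_mono mult_left_mono normsq_evolution_le assms gns.normsq_nonneg)

end

section \<open>Right Haar measure, set integrals and a Cauchy criterion\<close>

lemma
  fixes \<mu> :: "'g::{topological_group_add, t2_space} measure"
  assumes "right_haar_measure \<mu>"
  shows sets_right_haar: "sets \<mu> = sets borel"
    and distr_right_haar: "distr \<mu> \<mu> (\<lambda>k. k + h) = \<mu>"
    and borel_translate: "\<Lambda> \<in> sets borel \<Longrightarrow> (\<lambda>k. k + h) ` \<Lambda> \<in> sets borel"
    and emeasure_translate: "\<Lambda> \<in> sets borel \<Longrightarrow> emeasure \<mu> ((\<lambda>k. k + h) ` \<Lambda>) = emeasure \<mu> \<Lambda>"
    and measurable_translate: "(\<lambda>k. k + h) \<in> measurable \<mu> \<mu>"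
proof -
  show s: "sets \<mu> = sets borel"
    and e: "\<And>\<Lambda> h. \<Lambda> \<in> sets borel \<Longrightarrow> emeasure \<mu> ((\<lambda>k. k + h) ` \<Lambda>) = emeasure \<mu> \<Lambda>"
    using assms by (auto simp: right_haar_measure_def)
  have sp: "space \<mu> = UNIV"
    using sets_eq_imp_space_eq[OF s] by simp
  have m: "(\<lambda>k. k + h) \<in> borel_measurable borel" for h :: 'g
    by (intro borel_measurable_continuous_onI continuous_intros)
  \<comment> \<open>Writing a translate as a preimage under the inverse translation reduces its
    measurability to continuity.\<close>
  have im: "(\<lambda>k. k + h) ` X = (\<lambda>k. k + (- h)) -` X" for h :: 'g and X
    by (force simp: image_iff)
  show mm: "(\<lambda>k. k + h) \<in> measurable \<mu> \<mu>"
    using m measurable_cong_sets[OF s s] by blast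
  show "\<Lambda> \<in> sets borel \<Longrightarrow> (\<lambda>k. k + h) ` \<Lambda> \<in> sets borel"
    using measurable_sets[OF m[of "- h"], of \<Lambda>] by (simp add: im[of h])
  show "distr \<mu> \<mu> (\<lambda>k. k + h) = \<mu>"
  proof (rule measure_eqI)
    fix X assume "X \<in> sets (distr \<mu> \<mu> (\<lambda>k. k + h))"
    then have "X \<in> sets \<mu>" by simp
    then show "emeasure (distr \<mu> \<mu> (\<lambda>k. k + h)) X = emeasure \<mu> X"
      using mm e[of X "- h"] im[of "- h" X] s by (simp add: emeasure_distr sp)
  qed simp
qed

text \<open>Measurability of \<open>f\<close> is known on \<open>K\<close> only, so \<open>f\<close>
  is first cut off by the indicator of \<open>K\<close>, which changes nothing on \<Lambda>.\<close>

lemma set_integrable_bounded: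
  fixes f :: "'g::topological_space \<Rightarrow> complex"
  assumes "sets \<mu> = sets borel" "K \<in> sets borel"
    and "f \<in> borel_measurable (restrict_space borel K)"
    and "\<And>g. g \<in> K \<Longrightarrow> cmod (f g) \<le> M"
    and "\<Lambda> \<in> sets borel" "\<Lambda> \<subseteq> K" "emeasure \<mu> \<Lambda> < \<infinity>"
  shows "set_integrable \<mu> \<Lambda> f"
proof -
  have "(\<lambda>g. indicator K g *\<^sub>R f g) \<in> borel_measurable borel"
    using assms(2,3) by (simp add: borel_measurable_restrict_space_iff)
  then have "(\<lambda>g. indicator K g *\<^sub>R f g) \<in> borel_measurable \<mu>"
    using measurable_cong_sets[OF assms(1) refl] by blast
  then have "integrable \<mu> (\<lambda>g. indicator \<Lambda> g *\<^sub>R (indicator K g *\<^sub>R f g))"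
    by (rule integrableI_bounded_set_indicator[rotated, where B = M])
       (use assms in \<open>auto simp: indicator_def intro!: AE_I2\<close>)
  also have "(\<lambda>g. indicator \<Lambda> g *\<^sub>R (indicator K g *\<^sub>R f g)) = (\<lambda>g. indicator \<Lambda> g *\<^sub>R f g)"
    using assms(6) by (auto simp: fun_eq_iff indicator_def)
  finally show ?thesis
    by (simp add: set_integrable_def)
qed

lemma set_integral_translate:
  fixes f :: "'g::{topological_group_add, t2_space} \<Rightarrow> complex"
  assumes haar: "right_haar_measure \<mu>" and "\<Lambda> \<in> sets borel"
    and int: "set_integrable \<mu> ((\<lambda>k. k + h) ` \<Lambda>) f"
  shows "(LINT k:(\<lambda>k. k + h) ` \<Lambda>|\<mu>. f k) = (LINT k:\<Lambda>|\<mu>. f (k + h))"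
proof -
  let ?F = "\<lambda>k. indicator ((\<lambda>k. k + h) ` \<Lambda>) k *\<^sub>R f k"
  have "(LINT k|\<mu>. ?F k) = (LINT k|distr \<mu> \<mu> (\<lambda>k. k + h). ?F k)"
    by (simp add: distr_right_haar[OF haar])
  also have "\<dots> = (LINT k|\<mu>. ?F (k + h))"
    by (rule integral_distr[OF measurable_translate[OF haar]])
       (use int in \<open>simp add: set_integrable_def\<close>)
  also have "(\<lambda>k. ?F (k + h)) = (\<lambda>k. indicator \<Lambda> k *\<^sub>R f (k + h))"
    by (auto simp: fun_eq_iff indicator_def)
  finally show ?thesis
    by (simp add: set_lebesgue_integral_def)
qed

text \<open>The two integrands cancel on the intersection, so only the symmetric difference
  contributes.\<close>

lemma set_integral_diff_le:
  fixes f :: "'b \<Rightarrow> complex"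
  assumes "set_integrable \<mu> U f" "set_integrable \<mu> V f"
    and "U \<in> fmeasurable \<mu>" "V \<in> fmeasurable \<mu>"
    and bd: "\<And>g. g \<in> U \<union> V \<Longrightarrow> cmod (f g) \<le> M"
  shows "cmod ((LINT k:U|\<mu>. f k) - (LINT k:V|\<mu>. f k)) \<le> M * measure \<mu> ((U \<union> V) - (U \<inter> V))"
proof -
  let ?W = "(U \<union> V) - (U \<inter> V)"
  have W: "?W \<in> fmeasurable \<mu>"
    using assms(3,4) by (intro fmeasurable.Diff fmeasurable.Un fmeasurable.Int)
  have "(LINT k:U|\<mu>. f k) - (LINT k:V|\<mu>. f k)
      = (LINT k|\<mu>. indicator U k *\<^sub>R f k - indicator V k *\<^sub>R f k)"
    using assms(1,2) by (simp add: set_lebesgue_integral_def set_integrable_def)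
  also have "cmod \<dots> \<le> (LINT k|\<mu>. M * indicator ?W k)"
  proof (rule order_trans[OF integral_norm_bound integral_mono])
    show "integrable \<mu> (\<lambda>k. cmod (indicator U k *\<^sub>R f k - indicator V k *\<^sub>R f k))"
      using assms(1,2) by (simp add: set_integrable_def)
    show "integrable \<mu> (\<lambda>k. M * indicator ?W k)"
      using W by (intro integrable_mult_right integrable_real_indicator) (auto simp: fmeasurable_def)
    show "cmod (indicator U k *\<^sub>R f k - indicator V k *\<^sub>R f k) \<le> M * indicator ?W k" for k
      using bd[of k] by (auto simp: indicator_def)
  qed
  also have "\<dots> = M * measure \<mu> ?W"
    using W by (simp add: fmeasurable_def)
  finally show ?thesis .
qed

text \<open>The centre \<open>c\<close> may depend on \<open>e\<close>: values near a common centre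
  are near each other, which is the Cauchy property. Below, \<open>c\<close> is \<langle>A,
  C\<rangle> with a mean \<open>C\<close> chosen for \<open>e\<close>.\<close>

lemma convergent_if_nearly_constant:
  fixes x :: "'i \<Rightarrow> 'b::complete_space"
  assumes "F \<noteq> bot" and near: "\<And>e. e > 0 \<Longrightarrow> \<exists>c. eventually (\<lambda>i. dist (x i) c < e) F"
  shows "\<exists>L. (x \<longlongrightarrow> L) F"
proof -
  have "cauchy_filter (filtermap x F)"
    unfolding cauchy_filter_metric_filtermap
  proof (intro allI impI)
    fix e :: real assume "e > 0"
    then obtain c where "eventually (\<lambda>i. dist (x i) c < e / 2) F"
      using near[of "e / 2"] by auto
    then show "\<exists>P. eventually P F \<and> (\<forall>i j. P i \<and> P j \<longrightarrow> dist (x i) (x j) < e)"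
      using dist_triangle_half_l by blast
  qed
  moreover have "filtermap x F \<noteq> bot"
    using assms(1) by (simp add: filtermap_bot_iff)
  ultimately obtain L where "filtermap x F \<le> nhds L"
    using complete_uniform[of "UNIV :: 'b set"] complete_UNIV by auto
  then show ?thesis
    by (auto simp: filterlim_def)
qed

text \<open>Serves twice: with \<open>c\<close> = \<langle>A, C\<rangle> to locate the averages, and
  with \<open>c = 0\<close> to bound an average by a bound on its integrand.\<close>

lemma set_average_dist_le:
  fixes f :: "'b \<Rightarrow> complex"
  assumes "set_integrable \<mu> U f" "U \<in> fmeasurable \<mu>" "measure \<mu> U > 0"
    and near: "\<And>k. k \<in> U \<Longrightarrow> cmod (f k - c) \<le> e"
  shows "cmod (of_real (1 / measure \<mu> U) * (LINT k:U|\<mu>. f k) - c) \<le> e"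
proof -
  have c: "integrable \<mu> (\<lambda>k. indicator U k *\<^sub>R c)"
    using assms(2) by (intro integrable_scaleR_left integrable_real_indicator) (auto simp: fmeasurable_def)
  have "(LINT k:U|\<mu>. f k) - of_real (measure \<mu> U) * c
      = (LINT k|\<mu>. indicator U k *\<^sub>R f k - indicator U k *\<^sub>R c)"
    using assms(1,2) c
    by (simp add: set_lebesgue_integral_def set_integrable_def fmeasurable_def scaleR_conv_of_real)
  also have "cmod \<dots> \<le> (LINT k|\<mu>. e * indicator U k)"
  proof (rule order_trans[OF integral_norm_bound integral_mono])
    show "integrable \<mu> (\<lambda>k. cmod (indicator U k *\<^sub>R f k - indicator U k *\<^sub>R c))"
      using assms(1) c by (simp add: set_integrable_def)
    show "integrable \<mu> (\<lambda>k. e * indicator U k)"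
      using assms(2) by (intro integrable_mult_right integrable_real_indicator) (auto simp: fmeasurable_def)
    show "cmod (indicator U k *\<^sub>R f k - indicator U k *\<^sub>R c) \<le> e * indicator U k" for k
      using near[of k] by (auto simp: indicator_def)
  qed
  also have "\<dots> = e * measure \<mu> U"
    using assms(2) by (simp add: fmeasurable_def)
  finally have "cmod ((LINT k:U|\<mu>. f k) - of_real (measure \<mu> U) * c) / measure \<mu> U \<le> e"
    using assms(3) by (simp add: field_simps)
  moreover have "of_real (1 / measure \<mu> U) * (LINT k:U|\<mu>. f k) - c
      = ((LINT k:U|\<mu>. f k) - of_real (measure \<mu> U) * c) / of_real (measure \<mu> U)"
    using assms(3) by (simp add: field_simps)
  ultimately show ?thesis
    using assms(3) by (simp add: norm_divide)
qed

section \<open>Averages of matrix coefficients over a space-filling net\<close>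

locale abelian_averaging = star_dynamical_system scale star \<omega> \<tau> K
  for scale :: "complex \<Rightarrow> 'a::ring_1 \<Rightarrow> 'a" and star :: "'a \<Rightarrow> 'a" and \<omega> :: "'a \<Rightarrow> complex"
    and \<tau> :: "'g::{topological_group_add, t2_space} \<Rightarrow> 'a \<Rightarrow> 'a" and K :: "'g set" +
  fixes \<mu> :: "'g measure" and I :: "'i set" and le :: "'i \<Rightarrow> 'i \<Rightarrow> bool" and \<Lambda> :: "'i \<Rightarrow> 'g set"
  assumes haar: "right_haar_measure \<mu>"
    and abelian: "g \<in> K \<Longrightarrow> h \<in> K \<Longrightarrow> g + h = h + g"
    and directed: "directed_set I le"
    and filling: "space_filling \<mu> K I le \<Lambda>"
begin

definition average :: "'g set \<Rightarrow> 'a \<Rightarrow> 'a \<Rightarrow> complex" where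
  "average U A X = of_real (1 / measure \<mu> U) * (LINT g:U|\<mu>. \<omega> (star A * \<tau> g X))"

definition averageable :: "'g set \<Rightarrow> bool" where
  "averageable U \<longleftrightarrow> U \<in> sets borel \<and> U \<subseteq> K \<and> emeasure \<mu> U < \<infinity> \<and> measure \<mu> U > 0"

lemma averageable_fmeasurable: "averageable U \<Longrightarrow> U \<in> fmeasurable \<mu>"
  by (auto simp: averageable_def fmeasurable_def sets_right_haar[OF haar])

lemma averageable_translate:
  assumes "averageable U" "h \<in> K"
  shows "averageable ((\<lambda>k. k + h) ` U)"
    and "measure \<mu> ((\<lambda>k. k + h) ` U) = measure \<mu> U"
proof -
  show "measure \<mu> ((\<lambda>k. k + h) ` U) = measure \<mu> U"
    using assms by (simp add: measure_def averageable_def emeasure_translate[OF haar])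
  moreover have "(\<lambda>k. k + h) ` U \<subseteq> K"
    using assms add_mem unfolding averageable_def by blast
  ultimately show "averageable ((\<lambda>k. k + h) ` U)"
    using assms by (simp add: averageable_def emeasure_translate[OF haar] borel_translate[OF haar])
qed

lemma
  shows filling_sets: "\<And>\<alpha>. \<alpha> \<in> I \<Longrightarrow> \<Lambda> \<alpha> \<in> sets borel \<and> \<Lambda> \<alpha> \<subseteq> K \<and> emeasure \<mu> (\<Lambda> \<alpha>) < \<infinity>"
    and filling_pos: "\<exists>a\<in>I. \<forall>\<alpha>\<in>I. le a \<alpha> \<longrightarrow> emeasure \<mu> (\<Lambda> \<alpha>) > 0"
    and filling_tendsto: "\<And>g. g \<in> K \<Longrightarrow>
      ((\<lambda>\<alpha>. measure \<mu> ((\<Lambda> \<alpha> \<union> (\<lambda>k. k + g) ` \<Lambda> \<alpha>) - (\<Lambda> \<alpha> \<inter> (\<lambda>k. k + g) ` \<Lambda> \<alpha>))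
        / measure \<mu> (\<Lambda> \<alpha>)) \<longlongrightarrow> 0) (net_filter I le)"
  using filling[unfolded space_filling_def] by (elim conjE; simp)+

lemma eventually_averageable: "eventually (\<lambda>\<alpha>. \<alpha> \<in> I \<and> averageable (\<Lambda> \<alpha>)) (net_filter I le)"
proof -
  have *: "averageable (\<Lambda> \<alpha>)" if "\<alpha> \<in> I" "emeasure \<mu> (\<Lambda> \<alpha>) > 0" for \<alpha>
    using filling_sets[OF that(1)] that(2)
    by (simp add: averageable_def measure_def enn2real_positive_iff)
  obtain a where "a \<in> I" "\<forall>\<alpha>\<in>I. le a \<alpha> \<longrightarrow> emeasure \<mu> (\<Lambda> \<alpha>) > 0"
    using filling_pos by (elim bexE)
  with * show ?thesis
    unfolding eventually_net_filter[OF directed] by (intro bexI[of _ a]) simp_all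
qed

lemma net_filter_ne_bot: "net_filter I le \<noteq> bot"
proof -
  have "\<exists>\<alpha>\<in>I. le a \<alpha>" if "a \<in> I" for a
    using directed that by (metis directed_set_def)
  then show ?thesis
    unfolding trivial_limit_def eventually_net_filter[OF directed] by blast
qed

lemma K_nonempty: "K \<noteq> {}"
  using eventually_happens'[OF net_filter_ne_bot eventually_averageable]
  by (auto simp: averageable_def)

lemma integrable_matrix_coefficient:
  assumes "averageable U"
  shows "set_integrable \<mu> U (\<lambda>g. \<omega> (star A * \<tau> g X))"
  using assms
  by (intro set_integrable_bounded[OF sets_right_haar[OF haar] borel_K evolution_measurable
        cmod_matrix_coefficient_le]) (auto simp: averageable_def)

lemma integral_translate:
  assumes "averageable U" "h \<in> K"
  shows "(LINT g:(\<lambda>k. k + h) ` U|\<mu>. \<omega> (star A * \<tau> g X)) = (LINT g:U|\<mu>. \<omega> (star A * \<tau> g (\<tau> h X)))"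
proof -
  have "(LINT g:(\<lambda>k. k + h) ` U|\<mu>. \<omega> (star A * \<tau> g X)) = (LINT g:U|\<mu>. \<omega> (star A * \<tau> (g + h) X))"
    using assms
    by (intro set_integral_translate[OF haar] integrable_matrix_coefficient averageable_translate)
       (auto simp: averageable_def)
  also have "\<dots> = (LINT g:U|\<mu>. \<omega> (star A * \<tau> g (\<tau> h X)))"
    using assms
    by (intro set_lebesgue_integral_cong)
       (auto simp: averageable_def evolution_evolution sets_right_haar[OF haar])
  finally show ?thesis .
qed

text \<open>Trades a translate of the domain for an evolution of the observable. By right invariance
  both sides carry the same normalisation.\<close>

lemma average_translate:
  assumes "averageable U" "h \<in> K"
  shows "average U A (\<tau> h X) = average ((\<lambda>k. k + h) ` U) A X"
  using assms by (simp add: average_def integral_translate averageable_translate(2))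

lemma average_midpoint:
  assumes "averageable U"
  shows "average U A (scale (1/2) (X + Y)) = (average U A X + average U A Y) / 2"
proof -
  have "(LINT g:U|\<mu>. \<omega> (star A * \<tau> g (scale (1/2) (X + Y))))
      = (LINT g:U|\<mu>. (\<omega> (star A * \<tau> g X) + \<omega> (star A * \<tau> g Y)) / 2)"
    using assms
    by (intro set_lebesgue_integral_cong)
       (auto simp: averageable_def sets_right_haar[OF haar] evolution_add evolution_scale
          gns.add_right gns.scale_right)
  also have "\<dots> = ((LINT g:U|\<mu>. \<omega> (star A * \<tau> g X)) + (LINT g:U|\<mu>. \<omega> (star A * \<tau> g Y))) / 2"
    by (simp add: set_integral_add integrable_matrix_coefficient[OF assms])
  finally show ?thesis
    by (simp only: average_def) (simp add: add_divide_distrib mult.commute)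
qed

text \<open>Averaging \<open>\<tau> g X\<close> over \<open>U\<close> is averaging \<open>X\<close>
  over the translate of \<open>U\<close> by \<open>g\<close>, so the difference lives on the
  symmetric difference of the two sets.\<close>

lemma average_coboundary_le:
  assumes "averageable U" "g \<in> K"
  shows "cmod (average U A X - average U A (\<tau> g X)) \<le> sqrt (gns.normsq A * gns.normsq X) *
    (measure \<mu> ((U \<union> (\<lambda>k. k + g) ` U) - (U \<inter> (\<lambda>k. k + g) ` U)) / measure \<mu> U)"
proof -
  let ?V = "(\<lambda>k. k + g) ` U"
  have V: "averageable ?V"
    by (rule averageable_translate(1)[OF assms])
  have "cmod ((LINT k:U|\<mu>. \<omega> (star A * \<tau> k X)) - (LINT k:?V|\<mu>. \<omega> (star A * \<tau> k X)))
      \<le> sqrt (gns.normsq A * gns.normsq X) * measure \<mu> ((U \<union> ?V) - (U \<inter> ?V))"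
    using assms(1) V
    by (intro set_integral_diff_le integrable_matrix_coefficient averageable_fmeasurable
          cmod_matrix_coefficient_le) (auto simp: averageable_def)
  then have "cmod ((LINT k:U|\<mu>. \<omega> (star A * \<tau> k X)) - (LINT k:?V|\<mu>. \<omega> (star A * \<tau> k X))) / measure \<mu> U
      \<le> sqrt (gns.normsq A * gns.normsq X) * measure \<mu> ((U \<union> ?V) - (U \<inter> ?V)) / measure \<mu> U"
    by (rule divide_right_mono) simp
  then show ?thesis
    by (simp add: average_def averageable_translate(2)[OF assms] integral_translate[OF assms]
          norm_divide flip: diff_divide_distrib)
qed

text \<open>\<open>T = id\<close> gives the averages over \<open>\<Lambda> \<alpha>\<close>, and \<open>T = \<tau> h\<close> those over its right translate by \<open>h\<close>.\<close>

lemma eventually_average_orbit_means: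
  assumes "C \<in> orbit_means scale \<tau> K B" "e > 0"
  shows "eventually (\<lambda>\<alpha>. \<forall>T\<in>insert id (\<tau> ` K).
    cmod (average (\<Lambda> \<alpha>) A (T B) - average (\<Lambda> \<alpha>) A (T C)) < e) (net_filter I le)"
  using assms(1)
proof induction
  case (orbit g)
  let ?m = "\<lambda>\<alpha>. measure \<mu> ((\<Lambda> \<alpha> \<union> (\<lambda>k. k + g) ` \<Lambda> \<alpha>) - (\<Lambda> \<alpha> \<inter> (\<lambda>k. k + g) ` \<Lambda> \<alpha>)) / measure \<mu> (\<Lambda> \<alpha>)"
  let ?M = "sqrt (gns.normsq A * gns.normsq B)"
  have "(?m \<longlongrightarrow> 0) (net_filter I le)"
    by (rule filling_tendsto[OF orbit])
  then have "((\<lambda>\<alpha>. ?M * ?m \<alpha>) \<longlongrightarrow> 0) (net_filter I le)"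
    by (rule tendsto_mult_right_zero)
  then have "eventually (\<lambda>\<alpha>. ?M * ?m \<alpha> < e) (net_filter I le)"
    using assms(2) by (rule order_tendstoD(2))
  then show ?case
    using eventually_averageable
  proof eventually_elim
    case (elim \<alpha>)
    show ?case
    proof
      fix T assume T: "T \<in> insert id (\<tau> ` K)"
      \<comment> \<open>Commutativity of \<open>K\<close> enters here: it turns the difference into
        a coboundary of \<open>T B\<close>.\<close>
      then have "T (\<tau> g B) = \<tau> g (T B)"
        using orbit abelian by (auto simp: evolution_evolution)
      then have "cmod (average (\<Lambda> \<alpha>) A (T B) - average (\<Lambda> \<alpha>) A (T (\<tau> g B)))
          \<le> sqrt (gns.normsq A * gns.normsq (T B)) * ?m \<alpha>"
        using elim average_coboundary_le[OF _ orbit] by simp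
      \<comment> \<open>Contractivity replaces \<open>T B\<close> by \<open>B\<close>, making the
        bound independent of \<open>T\<close>.\<close>
      also have "\<dots> \<le> ?M * ?m \<alpha>"
        using T normsq_evolution_le[of _ B]
        by (intro mult_right_mono real_sqrt_le_mono mult_left_mono gns.normsq_nonneg) auto
      finally show "cmod (average (\<Lambda> \<alpha>) A (T B) - average (\<Lambda> \<alpha>) A (T (\<tau> g B))) < e"
        using elim by simp
    qed
  qed
next
  case (midpoint C D)
  show ?case
    using midpoint.IH eventually_averageable
  proof eventually_elim
    case (elim \<alpha>)
    show ?case
    proof
      fix T assume T: "T \<in> insert id (\<tau> ` K)"
      have "T (scale (1/2) (C + D)) = scale (1/2) (T C + T D)"
        using T by (auto simp: evolution_add evolution_scale)
      then have "average (\<Lambda> \<alpha>) A (T B) - average (\<Lambda> \<alpha>) A (T (scale (1/2) (C + D)))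
          = ((average (\<Lambda> \<alpha>) A (T B) - average (\<Lambda> \<alpha>) A (T C))
            + (average (\<Lambda> \<alpha>) A (T B) - average (\<Lambda> \<alpha>) A (T D))) / 2"
        by (simp only: average_midpoint[OF conjunct2[OF elim(3)]]) (simp add: field_simps)
      moreover have "cmod (average (\<Lambda> \<alpha>) A (T B) - average (\<Lambda> \<alpha>) A (T C)) < e"
        "cmod (average (\<Lambda> \<alpha>) A (T B) - average (\<Lambda> \<alpha>) A (T D)) < e"
        using elim T by auto
      ultimately show "cmod (average (\<Lambda> \<alpha>) A (T B) - average (\<Lambda> \<alpha>) A (T (scale (1/2) (C + D)))) < e"
        using norm_triangle_ineq[of "average (\<Lambda> \<alpha>) A (T B) - average (\<Lambda> \<alpha>) A (T C)"
            "average (\<Lambda> \<alpha>) A (T B) - average (\<Lambda> \<alpha>) A (T D)"]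
        by (simp only: norm_divide) simp
    qed
  qed
qed

section \<open>Limits of the averages, uniformly over translates\<close>

lemma eventually_average_near:
  assumes C: "C \<in> orbit_means scale \<tau> K B"
    and inv: "\<And>g. g \<in> K \<Longrightarrow> gns.normsq (\<tau> g C - C) \<le> \<delta>"
    and e: "sqrt (gns.normsq A * \<delta>) < e"
  shows "eventually (\<lambda>\<alpha>. \<forall>T\<in>insert id (\<tau> ` K).
    cmod (average (\<Lambda> \<alpha>) A (T B) - \<omega> (star A * C)) < e) (net_filter I le)"
proof -
  let ?r = "sqrt (gns.normsq A * \<delta>)"
  have near: "cmod (\<omega> (star A * \<tau> g C) - \<omega> (star A * C)) \<le> ?r" if "g \<in> K" for g
  proof -
    have "cmod (\<omega> (star A * (\<tau> g C - C))) \<le> ?r"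
      by (rule order_trans[OF gns.cmod_le_sqrt])
         (intro real_sqrt_le_mono mult_left_mono inv that gns.normsq_nonneg)
    then show ?thesis
      by (simp only: gns.diff_right)
  qed
  \<comment> \<open>Of the total error \<open>e\<close>, \<open>?r\<close> pays for replacing the
    coefficients of \<open>T C\<close> by \<langle>A, C\<rangle>; the rest is available for passing
    from \<open>T B\<close> to \<open>T C\<close>.\<close>
  have "e - ?r > 0"
    using e by simp
  from eventually_average_orbit_means[OF C this, of A] eventually_averageable show ?thesis
  proof eventually_elim
    case (elim \<alpha>)
    show ?case
    proof
      fix T assume T: "T \<in> insert id (\<tau> ` K)"
      have "cmod (average (\<Lambda> \<alpha>) A (T C) - \<omega> (star A * C)) \<le> ?r"
        unfolding average_def
      proof (rule set_average_dist_le)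
        fix k assume "k \<in> \<Lambda> \<alpha>"
        then have k: "k \<in> K"
          using elim by (auto simp: averageable_def)
        \<comment> \<open>For \<open>T = \<tau> h\<close> the vector is
          \<open>\<tau> (k + h) C\<close> with \<open>k + h\<close> in \<open>K\<close>, so almost
          invariance of \<open>C\<close> covers both kinds of \<open>T\<close>.\<close>
        show "cmod (\<omega> (star A * \<tau> k (T C)) - \<omega> (star A * C)) \<le> ?r"
          using T k by (auto simp: evolution_evolution intro!: near add_mem)
      qed (use elim in \<open>auto simp: averageable_def intro!: integrable_matrix_coefficient
              averageable_fmeasurable\<close>)
      moreover have "cmod (average (\<Lambda> \<alpha>) A (T B) - average (\<Lambda> \<alpha>) A (T C)) < e - ?r"
        using elim T by blast
      ultimately show "cmod (average (\<Lambda> \<alpha>) A (T B) - \<omega> (star A * C)) < e"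
        using norm_triangle_ineq[of "average (\<Lambda> \<alpha>) A (T B) - average (\<Lambda> \<alpha>) A (T C)"
            "average (\<Lambda> \<alpha>) A (T C) - \<omega> (star A * C)"] by simp
    qed
  qed
qed

lemma obtain_approximating_mean:
  assumes "e > 0"
  obtains C where "C \<in> orbit_means scale \<tau> K B"
    and "eventually (\<lambda>\<alpha>. \<forall>T\<in>insert id (\<tau> ` K).
      cmod (average (\<Lambda> \<alpha>) A (T B) - \<omega> (star A * C)) < e) (net_filter I le)"
    and "\<And>D. D \<in> orbit_means scale \<tau> K A \<Longrightarrow> cmod (\<omega> (star A * C) - \<omega> (star D * C)) < e"
proof -
  \<comment> \<open>This makes \<open>sqrt (gns.normsq A * \<delta>)\<close> less than
    \<open>e / 2\<close>, the half absorbing the factor 2 of \<open>cmod_diff_orbit_means\<close>;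
    the \<open>+ 1\<close> covers an \<open>A\<close> of seminorm zero.\<close>
  define \<delta> where "\<delta> = (e / 2)\<^sup>2 / (gns.normsq A + 1)"
  have pos: "gns.normsq A + 1 > 0"
    using gns.normsq_nonneg[of A] by simp
  then have "\<delta> > 0"
    using assms by (simp add: \<delta>_def)
  have "gns.normsq A * \<delta> < (e / 2)\<^sup>2"
    using pos assms by (simp add: \<delta>_def divide_simps)
  then have small: "sqrt (gns.normsq A * \<delta>) < e / 2"
    using assms by (intro real_less_lsqrt) auto
  obtain C where C: "C \<in> orbit_means scale \<tau> K B"
    "\<And>g. g \<in> K \<Longrightarrow> gns.normsq (\<tau> g C - C) \<le> \<delta>"
    "\<And>g. g \<in> K \<Longrightarrow> gns.normsq C - gns.normsq (\<tau> g C) \<le> \<delta>"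
    using almost_invariant_mean[OF K_nonempty \<open>\<delta> > 0\<close>] by blast
  show thesis
  proof (rule that[OF C(1)])
    show "eventually (\<lambda>\<alpha>. \<forall>T\<in>insert id (\<tau> ` K).
        cmod (average (\<Lambda> \<alpha>) A (T B) - \<omega> (star A * C)) < e) (net_filter I le)"
      using small assms by (intro eventually_average_near[OF C(1,2)]) auto
    show "cmod (\<omega> (star A * C) - \<omega> (star D * C)) < e" if "D \<in> orbit_means scale \<tau> K A" for D
      using cmod_diff_orbit_means[OF that C(2,3)] small by linarith
  qed
qed

text \<open>The same \<langle>A, C\<rangle> approximates the averages of \<open>B\<close> and of
  every \<open>\<tau> h B\<close>. Going from the latter through \<langle>A, C\<rangle> and the
  average of \<open>B\<close> to \<open>L\<close> costs three times \<open>e / 3\<close>, whatever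
  \<open>h\<close> is.\<close>

lemma average_converges_uniformly:
  obtains L where "((\<lambda>\<alpha>. average (\<Lambda> \<alpha>) A B) \<longlongrightarrow> L) (net_filter I le)"
    and "\<And>e. e > 0 \<Longrightarrow>
      eventually (\<lambda>\<alpha>. \<forall>h\<in>K. cmod (average (\<Lambda> \<alpha>) A (\<tau> h B) - L) < e) (net_filter I le)"
proof -
  have "\<exists>c. eventually (\<lambda>\<alpha>. dist (average (\<Lambda> \<alpha>) A B) c < e) (net_filter I le)" if e: "e > 0" for e
  proof -
    obtain C where "eventually (\<lambda>\<alpha>. \<forall>T\<in>insert id (\<tau> ` K).
        cmod (average (\<Lambda> \<alpha>) A (T B) - \<omega> (star A * C)) < e) (net_filter I le)"
      by (rule obtain_approximating_mean[OF e, where A = A and B = B]) (rule that)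
    then show ?thesis
      by (intro exI[of _ "\<omega> (star A * C)"]) (auto elim!: eventually_mono simp: dist_norm)
  qed
  then obtain L where L: "((\<lambda>\<alpha>. average (\<Lambda> \<alpha>) A B) \<longlongrightarrow> L) (net_filter I le)"
    using convergent_if_nearly_constant[OF net_filter_ne_bot, of "\<lambda>\<alpha>. average (\<Lambda> \<alpha>) A B"] by blast
  show thesis
  proof (rule that[OF L])
    fix e :: real assume e: "e > 0"
    then have e3: "e / 3 > 0" by simp
    obtain C where C: "eventually (\<lambda>\<alpha>. \<forall>T\<in>insert id (\<tau> ` K).
        cmod (average (\<Lambda> \<alpha>) A (T B) - \<omega> (star A * C)) < e / 3) (net_filter I le)"
      by (rule obtain_approximating_mean[OF e3, where A = A and B = B]) (rule that)
    have "eventually (\<lambda>\<alpha>. dist (average (\<Lambda> \<alpha>) A B) L < e / 3) (net_filter I le)"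
      by (rule tendstoD[OF L e3])
    with C show "eventually (\<lambda>\<alpha>. \<forall>h\<in>K. cmod (average (\<Lambda> \<alpha>) A (\<tau> h B) - L) < e) (net_filter I le)"
    proof eventually_elim
      case (elim \<alpha>)
      show ?case
      proof
        fix h assume "h \<in> K"
        then have "dist (average (\<Lambda> \<alpha>) A (\<tau> h B)) (\<omega> (star A * C)) < e / 3"
          "dist (average (\<Lambda> \<alpha>) A B) (\<omega> (star A * C)) < e / 3"
          using elim(1) by (auto simp: dist_norm)
        then have "dist (average (\<Lambda> \<alpha>) A (\<tau> h B)) L < e"
          using elim(2) dist_triangle[of "average (\<Lambda> \<alpha>) A (\<tau> h B)" L "\<omega> (star A * C)"]
            dist_triangle3[of "\<omega> (star A * C)" L "average (\<Lambda> \<alpha>) A B"] by linarith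
        then show "cmod (average (\<Lambda> \<alpha>) A (\<tau> h B) - L) < e"
          by (simp add: dist_norm)
      qed
    qed
  qed
qed

text \<open>\<open>L\<close> is within \<open>e / 2\<close> of \<langle>A, C\<rangle>, which is
  within \<open>e / 2\<close> of \<langle>C, C\<rangle> because \<open>C\<close> is itself a mean of
  the orbit of \<open>A\<close>.\<close>

lemma limit_ge_cmod_state_squared:
  assumes L: "((\<lambda>\<alpha>. average (\<Lambda> \<alpha>) A A) \<longlongrightarrow> L) (net_filter I le)"
  shows "(cmod (\<omega> A))\<^sup>2 \<le> cmod L"
proof (rule field_le_epsilon)
  fix e :: real assume e: "e > 0"
  obtain C where C: "C \<in> orbit_means scale \<tau> K A"
    and near: "eventually (\<lambda>\<alpha>. \<forall>T\<in>insert id (\<tau> ` K).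
        cmod (average (\<Lambda> \<alpha>) A (T A) - \<omega> (star A * C)) < e / 2) (net_filter I le)"
    and self: "\<And>D. D \<in> orbit_means scale \<tau> K A \<Longrightarrow> cmod (\<omega> (star A * C) - \<omega> (star D * C)) < e / 2"
    by (rule obtain_approximating_mean[OF half_gt_zero[OF e], where A = A and B = A]) (rule that)
  have "cmod (L - \<omega> (star A * C)) \<le> e / 2"
  proof (rule tendsto_upperbound[OF _ _ net_filter_ne_bot])
    show "((\<lambda>\<alpha>. cmod (average (\<Lambda> \<alpha>) A A - \<omega> (star A * C))) \<longlongrightarrow> cmod (L - \<omega> (star A * C))) (net_filter I le)"
      by (intro tendsto_intros L)
    show "eventually (\<lambda>\<alpha>. cmod (average (\<Lambda> \<alpha>) A A - \<omega> (star A * C)) \<le> e / 2) (net_filter I le)"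
      using near by (auto elim!: eventually_mono)
  qed
  then have "cmod (L - \<omega> (star C * C)) \<le> e"
    using self[OF C] norm_triangle_ineq[of "L - \<omega> (star A * C)" "\<omega> (star A * C) - \<omega> (star C * C)"]
    by simp
  moreover have "(cmod (\<omega> A))\<^sup>2 \<le> cmod (\<omega> (star C * C))"
    using cmod_state_le[of C] state_orbit_means[OF C] complex_Re_le_cmod[of "\<omega> (star C * C)"]
    by (simp add: gns.normsq_def)
  ultimately show "(cmod (\<omega> A))\<^sup>2 \<le> cmod L + e"
    using norm_triangle_ineq2[of "\<omega> (star C * C)" L] by (simp add: norm_minus_commute)
qed

end

section \<open>Recurrence at one index for all translates\<close>

theorem theorem3p3:
  fixes \<mu> :: "'g::{topological_group_add, t2_space} measure"
    and K :: "'g set"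
    and scale :: "complex \<Rightarrow> 'a::ring_1 \<Rightarrow> 'a"
    and star :: "'a \<Rightarrow> 'a"
    and \<omega> :: "'a \<Rightarrow> complex"
    and \<tau> :: "'g \<Rightarrow> 'a \<Rightarrow> 'a"
    and I :: "'i set"
    and le :: "'i \<Rightarrow> 'i \<Rightarrow> bool"
    and \<Lambda> :: "'i \<Rightarrow> 'g set"
    and A B :: 'a
  assumes "locally_compact_space (euclidean :: 'g topology)"
    and "right_haar_measure \<mu>"
    and "star_dynamical_system scale star \<omega> \<tau> K"
    and "\<forall>g\<in>K. \<forall>h\<in>K. g + h = h + g"
    and "directed_set I le"
    and "space_filling \<mu> K I le \<Lambda>"
  shows "\<exists>L. ((\<lambda>\<alpha>. complex_of_real (1 / measure \<mu> (\<Lambda> \<alpha>)) *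
                  (LINT g:\<Lambda> \<alpha>|\<mu>. \<omega> (star A * \<tau> g B))) \<longlongrightarrow> L) (net_filter I le) \<and>
    (\<forall>\<epsilon>>0. \<exists>\<alpha>\<^sub>0\<in>I. measure \<mu> (\<Lambda> \<alpha>\<^sub>0) > 0 \<and>
       (\<forall>h\<in>K. cmod (complex_of_real (1 / measure \<mu> (\<Lambda> \<alpha>\<^sub>0)) *
                 (LINT g:(\<lambda>k. k + h) ` \<Lambda> \<alpha>\<^sub>0|\<mu>. \<omega> (star A * \<tau> g B))) > cmod L - \<epsilon>) \<and>
       (A = B \<longrightarrow> (\<forall>h\<in>K. \<exists>g\<in>(\<lambda>k. k + h) ` \<Lambda> \<alpha>\<^sub>0.
                 cmod (\<omega> (star A * \<tau> g A)) > (cmod (\<omega> A))\<^sup>2 - \<epsilon>)))"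
proof -
  interpret abelian_averaging scale star \<omega> \<tau> K \<mu> I le \<Lambda>
    using assms by (intro abelian_averaging.intro abelian_averaging_axioms.intro) auto
  obtain L where L: "((\<lambda>\<alpha>. average (\<Lambda> \<alpha>) A B) \<longlongrightarrow> L) (net_filter I le)"
    and unif: "\<And>e. e > 0 \<Longrightarrow>
      eventually (\<lambda>\<alpha>. \<forall>h\<in>K. cmod (average (\<Lambda> \<alpha>) A (\<tau> h B) - L) < e) (net_filter I le)"
    using average_converges_uniformly by blast
  have "\<exists>\<alpha>\<^sub>0\<in>I. measure \<mu> (\<Lambda> \<alpha>\<^sub>0) > 0 \<and>
       (\<forall>h\<in>K. cmod (complex_of_real (1 / measure \<mu> (\<Lambda> \<alpha>\<^sub>0)) *
                 (LINT g:(\<lambda>k. k + h) ` \<Lambda> \<alpha>\<^sub>0|\<mu>. \<omega> (star A * \<tau> g B))) > cmod L - \<epsilon>) \<and>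
       (A = B \<longrightarrow> (\<forall>h\<in>K. \<exists>g\<in>(\<lambda>k. k + h) ` \<Lambda> \<alpha>\<^sub>0.
                 cmod (\<omega> (star A * \<tau> g A)) > (cmod (\<omega> A))\<^sup>2 - \<epsilon>))"
    if \<epsilon>: "\<epsilon> > 0" for \<epsilon>
  proof -
    \<comment> \<open>One index for which all translated averages are within \<epsilon> of
      \<open>L\<close> serves both assertions.\<close>
    obtain \<alpha> where \<alpha>: "\<alpha> \<in> I" "averageable (\<Lambda> \<alpha>)"
      and close: "\<And>h. h \<in> K \<Longrightarrow> cmod (average (\<Lambda> \<alpha>) A (\<tau> h B) - L) < \<epsilon>"
      using eventually_happens'[OF net_filter_ne_bot eventually_conj[OF eventually_averageable unif[OF \<epsilon>]]]
      by blast
    have large: "cmod (average ((\<lambda>k. k + h) ` \<Lambda> \<alpha>) A B) > cmod L - \<epsilon>" if "h \<in> K" for h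
      using close[OF that] norm_triangle_ineq2[of L "average (\<Lambda> \<alpha>) A (\<tau> h B)"]
      by (simp add: average_translate[OF \<alpha>(2) that] norm_minus_commute)
    show ?thesis
    proof (intro bexI[OF _ \<alpha>(1)] conjI ballI impI)
      show "measure \<mu> (\<Lambda> \<alpha>) > 0"
        using \<alpha>(2) by (simp add: averageable_def)
    next
      fix h assume h: "h \<in> K"
      show "cmod (complex_of_real (1 / measure \<mu> (\<Lambda> \<alpha>)) *
          (LINT g:(\<lambda>k. k + h) ` \<Lambda> \<alpha>|\<mu>. \<omega> (star A * \<tau> g B))) > cmod L - \<epsilon>"
        using large[OF h] by (simp only: average_def averageable_translate(2)[OF \<alpha>(2) h])
    next
      fix h assume "A = B" and h: "h \<in> K"
      let ?U = "(\<lambda>k. k + h) ` \<Lambda> \<alpha>"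
      have U: "averageable ?U"
        by (rule averageable_translate(1)[OF \<alpha>(2) h])
      show "\<exists>g\<in>?U. cmod (\<omega> (star A * \<tau> g A)) > (cmod (\<omega> A))\<^sup>2 - \<epsilon>"
      proof (rule ccontr)
        assume "\<not> ?thesis"
        \<comment> \<open>A bound on every coefficient over the translate passes to the average,
          which however exceeds \<open>cmod L - \<epsilon>\<close> and hence
          \<open>(cmod (\<omega> A))\<^sup>2 - \<epsilon>\<close>.\<close>
        then have "cmod (\<omega> (star A * \<tau> g A) - 0) \<le> (cmod (\<omega> A))\<^sup>2 - \<epsilon>" if "g \<in> ?U" for g
          using that by (auto simp: not_less)
        then have "cmod (average ?U A A - 0) \<le> (cmod (\<omega> A))\<^sup>2 - \<epsilon>"
          unfolding average_def
          using U by (intro set_average_dist_le integrable_matrix_coefficient averageable_fmeasurable)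
            (auto simp: averageable_def)
        then show False
          using large[OF h] limit_ge_cmod_state_squared[of A L] L \<open>A = B\<close> by simp
      qed
    qed
  qed
  with L show ?thesis
    unfolding average_def by blast
qed

end
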